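(* Let $N\ge1$ and let $\mathsf{g}_-$ be any function with $\mathsf{g}_-(\lambda+\eta/2)\,\mathsf{g}_-(-\lambda+\eta/2)=-\frac{(\sinh^2\lambda-\sinh^2\alpha_-)(\sinh^2\lambda+\cosh^2\beta_-)}{\sinh^2\alpha_-\cosh^2\beta_-}$, and put $\mathsf{A}_-(\lambda)=\mathsf{g}_-(\lambda)\,a(\lambda)\,d(-\lambda)$. Then the normalization coefficient $$N(\{\xi\},\beta)=\widehat V(\xi_1^{(0)},\dots,\xi_N^{(0)})\;\langle0|\prod_{j=1}^N\frac{\mathcal{A}_-^{\rm SOS}(\eta/2-\xi_j|\beta-1)}{\mathsf{A}_-(\eta/2-\xi_j)}\,|\underline0\rangle$$ is equal to $$N(\{\xi\},\beta)=(-1)^N\,\widehat V(\xi_1,\dots,\xi_N)\,\frac{\widehat V(\xi_1^{(0)},\dots,\xi_N^{(0)})}{\widehat V(\xi_1^{(1)},\dots,\xi_N^{(1)})}\prod_{j=1}^N\left[\frac{\mathsf{b}_-(\frac\eta2-\xi_j|\beta+1+N-2j)}{\mathsf{g}_-(\frac\eta2-\xi_j)}\,\frac{\sinh(\eta(\beta+1+N-2j))}{\sinh(\eta(\beta+N-j))}\right].$$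
   Context: **Parameters.** $\eta,\alpha,\beta\in\mathbb{C}$ with $\sinh(\eta(\beta+m))\neq0$ for all $m\in\mathbb{Z}$; boundary parameters $\varsigma_-,\kappa_-,\tau_-$, with $\alpha_-,\beta_-$ defined by $\sinh\alpha_-\cosh\beta_-=\frac{\sinh\varsigma_-}{2\kappa_-}$, $\cosh\alpha_-\sinh\beta_-=\frac{\cosh\varsigma_-}{2\kappa_-}$; inhomogeneities $\xi_1,\dots,\xi_N$, generic so that no denominator vanishes; $\xi_n^{(h)}=\xi_n+\eta/2-h\eta$, $h\in\{0,1\}$. $a(\lambda)=\prod_n\sinh(\lambda-\xi_n+\eta/2)$, $d(\lambda)=\prod_n\sinh(\lambda-\xi_n-\eta/2)$, $\widehat V(x_1,\dots,x_N)=\prod_{j<k}(\sinh^2x_k-\sinh^2x_j)$. **Operators.** $\mathcal{H}=\otimes_{n=1}^N\mathbb{C}^2$ with Pauli matrices $\sigma_n^z$, $\mathbf{S}^z=\sum_n\sigma_n^z$; auxiliary space $\mathcal{H}_0=\mathbb{C}^2$. In the basis $\uparrow\uparrow,\uparrow\downarrow,\downarrow\uparrow,\downarrow\downarrow$, $R^{\rm SOS}(\lambda|\beta)$ is the $4\times4$ matrix whose non-zero entries are $(1,1)=(4,4)=\sinh(\lambda+\eta)$, $(2,2)=\frac{\sinh(\eta(\beta+1))}{\sinh\eta\beta}\sinh\lambda$, $(2,3)=\frac{\sinh(\lambda+\eta\beta)}{\sinh\eta\beta}\sinh\eta$, $(3,2)=\frac{\sinh(\eta\beta-\lambda)}{\sinh\eta\beta}\sinh\eta$,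 $(3,3)=\frac{\sinh(\eta(\beta-1))}{\sinh\eta\beta}\sinh\lambda$; in $R^{\rm SOS}_{ab}$ the first tensor factor is space $a$, the second is space $b$. $M^{\rm SOS}(\lambda|\beta)=X_NX_{N-1}\cdots X_1$ with $X_n=R^{\rm SOS}_{n0}(\lambda-\xi_n-\frac\eta2|\beta+\sum_{j>n}\sigma^z_j)$; $\hat M^{\rm SOS}(\lambda|\beta)=Y_1Y_2\cdots Y_N$ with $Y_n=R^{\rm SOS}_{0n}(\lambda+\xi_n-\frac\eta2|\beta+\sum_{j>n}\sigma^z_j)$. $S(\lambda|\beta)=\begin{pmatrix}e^{\lambda-\eta(\beta+\alpha)}&e^{\lambda+\eta(\beta-\alpha)}\\1&1\end{pmatrix}$, $K_-(\lambda)=\frac1{\sinh\varsigma_-}\begin{pmatrix}\sinh(\lambda-\eta/2+\varsigma_-)&\kappa_-e^{\tau_-}\sinh(2\lambda-\eta)\\ \kappa_-e^{-\tau_-}\sinh(2\lambda-\eta)&\sinh(\varsigma_--\lambda+\eta/2)\end{pmatrix}$, $\mathcal{K}_-^{\rm SOS}(\lambda|\beta)=S^{-1}(-\lambda+\frac\eta2|\beta)K_-(\lambda)S(\lambda-\frac\eta2|\beta)$, and $\mathsf{b}_-(\lambda|\beta)$ denotes the $(1,2)$ entry of $\mathcal{K}_-^{\rm SOS}(\lambda|\beta)$. $\mathcal{A}_-^{\rm SOS}(\lambda|\beta)$ is the $(1,1)$ block (with respect to $\mathcal{H}_0$) of $\mathcal{U}_-^{\rm SOS}(\lambda|\beta)=M^{\rm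 SOS}(\lambda|\beta)\,\mathcal{K}_-^{\rm SOS}(\lambda|\beta+\mathbf{S}^z)\,\hat M^{\rm SOS}(\lambda|\beta)$. $\langle0|$ is the dual state with all spins up and $|\underline0\rangle$ the state with all spins down. The operator product is ordered with $j$ increasing from left to right. *)

theory Defs
  imports "HOL-Analysis.Analysis"
begin

section \<open>Spins, configurations and operators\<close>

datatype spin = Up | Down

instance spin :: finite
proof
  have "(UNIV :: spin set) \<subseteq> {Up, Down}"
    using spin.exhaust by blast
  then show "finite (UNIV :: spin set)"
    by (rule finite_subset) simp
qed

definition sz :: "spin \<Rightarrow> complex" where
  "sz i = (case i of Up \<Rightarrow> 1 | Down \<Rightarrow> - 1)"

definition mat22 :: "complex \<Rightarrow> complex \<Rightarrow> complex \<Rightarrow> complex \<Rightarrow> complex^spin^spin" where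
  "mat22 p q r s = (\<chi> i j. case i of
      Up \<Rightarrow> (case j of Up \<Rightarrow> p | Down \<Rightarrow> q)
    | Down \<Rightarrow> (case j of Up \<Rightarrow> r | Down \<Rightarrow> s))"

text \<open>The tensor product of copies of \<open>\<complex>\<^sup>2\<close> over a finite set \<open>I\<close> of sites has the basis
  \<open>confs I\<close>; an operator is given by its matrix in this basis, row index first. Only the entries
  with both indices in \<open>confs I\<close> are meaningful. The quantum sites are \<open>1, \<dots>, N\<close> and the
  auxiliary space \<open>\<H>\<^sub>0\<close> is site \<open>0\<close>.\<close>

type_synonym conf = "nat \<Rightarrow> spin"
type_synonym operator = "conf \<Rightarrow> conf \<Rightarrow> complex"

definition confs :: "nat set \<Rightarrow> conf set" where
  "confs I = I \<rightarrow>\<^sub>E UNIV"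

definition op_id :: operator where
  "op_id s t = (if s = t then 1 else 0)"

definition op_mult :: "nat set \<Rightarrow> operator \<Rightarrow> operator \<Rightarrow> operator" where
  "op_mult I A B s t = (\<Sum>w\<in>confs I. A s w * B w t)"

definition op_prod :: "nat set \<Rightarrow> operator list \<Rightarrow> operator" where
  "op_prod I As = foldr (op_mult I) As op_id"

definition all_up :: "nat \<Rightarrow> conf" where
  "all_up N = (\<lambda>n\<in>{1..N}. Up)"

definition all_down :: "nat \<Rightarrow> conf" where
  "all_down N = (\<lambda>n\<in>{1..N}. Down)"


section \<open>Scalar functions\<close>

definition Vhat :: "nat \<Rightarrow> (nat \<Rightarrow> complex) \<Rightarrow> complex" where
  "Vhat N x = (\<Prod>k\<in>{1..N}. \<Prod>j\<in>{1..<k}. (sinh (x k))\<^sup>2 - (sinh (x j))\<^sup>2)"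

definition xi_shift :: "complex \<Rightarrow> (nat \<Rightarrow> complex) \<Rightarrow> nat \<Rightarrow> nat \<Rightarrow> complex" where
  "xi_shift \<eta> \<xi> h n = \<xi> n + \<eta> / 2 - of_nat h * \<eta>"

definition a_fun :: "nat \<Rightarrow> complex \<Rightarrow> (nat \<Rightarrow> complex) \<Rightarrow> complex \<Rightarrow> complex" where
  "a_fun N \<eta> \<xi> u = (\<Prod>n\<in>{1..N}. sinh (u - \<xi> n + \<eta> / 2))"

definition d_fun :: "nat \<Rightarrow> complex \<Rightarrow> (nat \<Rightarrow> complex) \<Rightarrow> complex \<Rightarrow> complex" where
  "d_fun N \<eta> \<xi> u = (\<Prod>n\<in>{1..N}. sinh (u - \<xi> n - \<eta> / 2))"

definition A_coef ::
  "nat \<Rightarrow> complex \<Rightarrow> (nat \<Rightarrow> complex) \<Rightarrow> (complex \<Rightarrow> complex) \<Rightarrow> complex \<Rightarrow> complex" where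
  "A_coef N \<eta> \<xi> g u = g u * a_fun N \<eta> \<xi> u * d_fun N \<eta> \<xi> (- u)"


section \<open>Dynamical R-matrix and boundary matrix\<close>

text \<open>The spectral parameter is written \<open>u\<close>, and \<open>\<zeta>, \<kappa>, \<tau>\<close> are the boundary parameters
  usually written \<open>varsigma_-, kappa_-, tau_-\<close>.\<close>

fun R_SOS :: "complex \<Rightarrow> complex \<Rightarrow> complex \<Rightarrow> spin \<times> spin \<Rightarrow> spin \<times> spin \<Rightarrow> complex" where
  "R_SOS \<eta> u \<beta> (Up, Up) (Up, Up) = sinh (u + \<eta>)"
| "R_SOS \<eta> u \<beta> (Up, Down) (Up, Down) = sinh (\<eta> * (\<beta> + 1)) / sinh (\<eta> * \<beta>) * sinh u"
| "R_SOS \<eta> u \<beta> (Up, Down) (Down, Up) = sinh (u + \<eta> * \<beta>) / sinh (\<eta> * \<beta>) * sinh \<eta>"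
| "R_SOS \<eta> u \<beta> (Down, Up) (Up, Down) = sinh (\<eta> * \<beta> - u) / sinh (\<eta> * \<beta>) * sinh \<eta>"
| "R_SOS \<eta> u \<beta> (Down, Up) (Down, Up) = sinh (\<eta> * (\<beta> - 1)) / sinh (\<eta> * \<beta>) * sinh u"
| "R_SOS \<eta> u \<beta> (Down, Down) (Down, Down) = sinh (u + \<eta>)"
| "R_SOS \<eta> u \<beta> _ _ = 0"

definition S_mat :: "complex \<Rightarrow> complex \<Rightarrow> complex \<Rightarrow> complex \<Rightarrow> complex^spin^spin" where
  "S_mat \<eta> \<alpha> u \<beta> =
     mat22 (exp (u - \<eta> * (\<beta> + \<alpha>))) (exp (u + \<eta> * (\<beta> - \<alpha>)))
           1                          1"

definition K_minus ::
  "complex \<Rightarrow> complex \<Rightarrow> complex \<Rightarrow> complex \<Rightarrow> complex \<Rightarrow> complex^spin^spin" where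
  "K_minus \<eta> \<zeta> \<kappa> \<tau> u =
     mat22 (sinh (u - \<eta> / 2 + \<zeta>) / sinh \<zeta>) (\<kappa> * exp \<tau> * sinh (2 * u - \<eta>) / sinh \<zeta>)
           (\<kappa> * exp (- \<tau>) * sinh (2 * u - \<eta>) / sinh \<zeta>) (sinh (\<zeta> - u + \<eta> / 2) / sinh \<zeta>)"

definition K_SOS ::
  "complex \<Rightarrow> complex \<Rightarrow> complex \<Rightarrow> complex \<Rightarrow> complex \<Rightarrow> complex \<Rightarrow> complex \<Rightarrow> complex^spin^spin" where
  "K_SOS \<eta> \<alpha> \<zeta> \<kappa> \<tau> u \<beta> =
     matrix_inv (S_mat \<eta> \<alpha> (- u + \<eta> / 2) \<beta>) ** K_minus \<eta> \<zeta> \<kappa> \<tau> u ** S_mat \<eta> \<alpha> (u - \<eta> / 2) \<beta>"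

definition b_minus ::
  "complex \<Rightarrow> complex \<Rightarrow> complex \<Rightarrow> complex \<Rightarrow> complex \<Rightarrow> complex \<Rightarrow> complex \<Rightarrow> complex" where
  "b_minus \<eta> \<alpha> \<zeta> \<kappa> \<tau> u \<beta> = K_SOS \<eta> \<alpha> \<zeta> \<kappa> \<tau> u \<beta> $ Up $ Down"


section \<open>Monodromy matrices\<close>

text \<open>\<open>R_op \<eta> N a b J u \<beta>\<close> is \<open>R\<^sup>S\<^sup>O\<^sup>S\<^sub>a\<^sub>b(u|\<beta> + \<Sum>\<^sub>j\<^sub>\<in>\<^sub>J \<sigma>\<^sup>z\<^sub>j)\<close> acting on
  the sites \<open>0, \<dots>, N\<close>, for \<open>a, b \<notin> J\<close>. The operator-valued dynamical parameter is diagonal and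
  commutes with the action on the sites \<open>a, b\<close>, so it may be evaluated on the column index.
  The same holds in \<open>K_op\<close>, where the dynamical parameter is \<open>\<beta> + S\<^sup>z\<close>.\<close>

definition R_op ::
  "complex \<Rightarrow> nat \<Rightarrow> nat \<Rightarrow> nat \<Rightarrow> nat set \<Rightarrow> complex \<Rightarrow> complex \<Rightarrow> operator" where
  "R_op \<eta> N a b J u \<beta> s t =
     (if \<forall>j\<in>{0..N} - {a, b}. s j = t j
      then R_SOS \<eta> u (\<beta> + (\<Sum>j\<in>J. sz (t j))) (s a, s b) (t a, t b) else 0)"

definition K_op ::
  "nat \<Rightarrow> complex \<Rightarrow> complex \<Rightarrow> complex \<Rightarrow> complex \<Rightarrow> complex \<Rightarrow> complex \<Rightarrow> complex \<Rightarrow> operator" where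
  "K_op N \<eta> \<alpha> \<zeta> \<kappa> \<tau> u \<beta> s t =
     (if \<forall>j\<in>{1..N}. s j = t j
      then K_SOS \<eta> \<alpha> \<zeta> \<kappa> \<tau> u (\<beta> + (\<Sum>j\<in>{1..N}. sz (t j))) $ s 0 $ t 0 else 0)"

definition M_SOS :: "nat \<Rightarrow> complex \<Rightarrow> (nat \<Rightarrow> complex) \<Rightarrow> complex \<Rightarrow> complex \<Rightarrow> operator" where
  "M_SOS N \<eta> \<xi> u \<beta> = op_prod {0..N}
     (map (\<lambda>n. R_op \<eta> N n 0 {n<..N} (u - \<xi> n - \<eta> / 2) \<beta>) (rev [1..<Suc N]))"

definition Mhat_SOS :: "nat \<Rightarrow> complex \<Rightarrow> (nat \<Rightarrow> complex) \<Rightarrow> complex \<Rightarrow> complex \<Rightarrow> operator" where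
  "Mhat_SOS N \<eta> \<xi> u \<beta> = op_prod {0..N}
     (map (\<lambda>n. R_op \<eta> N 0 n {n<..N} (u + \<xi> n - \<eta> / 2) \<beta>) [1..<Suc N])"

definition U_SOS ::
  "nat \<Rightarrow> complex \<Rightarrow> complex \<Rightarrow> complex \<Rightarrow> complex \<Rightarrow> complex \<Rightarrow> (nat \<Rightarrow> complex) \<Rightarrow>
   complex \<Rightarrow> complex \<Rightarrow> operator" where
  "U_SOS N \<eta> \<alpha> \<zeta> \<kappa> \<tau> \<xi> u \<beta> = op_prod {0..N}
     [M_SOS N \<eta> \<xi> u \<beta>, K_op N \<eta> \<alpha> \<zeta> \<kappa> \<tau> u \<beta>, Mhat_SOS N \<eta> \<xi> u \<beta>]"

definition A_SOS ::
  "nat \<Rightarrow> complex \<Rightarrow> complex \<Rightarrow> complex \<Rightarrow> complex \<Rightarrow> complex \<Rightarrow> (nat \<Rightarrow> complex) \<Rightarrow>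
   complex \<Rightarrow> complex \<Rightarrow> operator" where
  "A_SOS N \<eta> \<alpha> \<zeta> \<kappa> \<tau> \<xi> u \<beta> s t = U_SOS N \<eta> \<alpha> \<zeta> \<kappa> \<tau> \<xi> u \<beta> (s(0 := Up)) (t(0 := Up))"


section \<open>The normalization coefficient\<close>

definition norm_coeff ::
  "nat \<Rightarrow> complex \<Rightarrow> complex \<Rightarrow> complex \<Rightarrow> complex \<Rightarrow> complex \<Rightarrow> (complex \<Rightarrow> complex) \<Rightarrow>
   (nat \<Rightarrow> complex) \<Rightarrow> complex \<Rightarrow> complex" where
  "norm_coeff N \<eta> \<alpha> \<zeta> \<kappa> \<tau> g \<xi> \<beta> =
     Vhat N (xi_shift \<eta> \<xi> 0) *
     op_prod {1..N}
       (map (\<lambda>j s t. A_SOS N \<eta> \<alpha> \<zeta> \<kappa> \<tau> \<xi> (\<eta> / 2 - \<xi> j) (\<beta> - 1) s t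
                      / A_coef N \<eta> \<xi> g (\<eta> / 2 - \<xi> j)) [1..<Suc N])
       (all_up N) (all_down N)"

end

theory Submission
  imports Defs
begin

text \<open>The \<open>R\<close>-matrix conserves the total number of down spins, and only the entry \<open>b_-\<close> of the boundary
  matrix raises it from row to column; so each of the \<open>N\<close> operators turns exactly one spin and
  contributes only through \<open>b_-\<close>. At \<open>u = \<eta>/2 - \<xi>\<^sub>j\<close> the \<open>j\<close>-th factor of the second monodromy matrix
  is \<open>sinh \<eta>\<close> times a permutation. Acting on row vectors from \<open>\<langle>0|\<close>, the \<open>j\<close>-th operator therefore maps
  the configuration with sites \<open>1, \<dots>, j - 1\<close> down to a multiple of the one with sites \<open>1, \<dots>, j\<close> down
  (up to terms with fewer down spins). In these multiples the ratios of sinh with the dynamical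
  parameter telescope, and the other factors assemble into the quotient of \<open>Vhat\<close>.\<close>

section \<open>Configurations and the count of down spins\<close>

lemma finite_confs: "finite I \<Longrightarrow> finite (confs I)"
  unfolding confs_def by (simp add: finite_PiE)

lemma fun_upd_confs: "s \<in> confs I \<Longrightarrow> a \<in> I \<Longrightarrow> s(a := x) \<in> confs I"
  unfolding confs_def by (auto simp: PiE_iff extensional_def)

lemma fun_upd_insert_confs: "s \<in> confs I \<Longrightarrow> s(a := x) \<in> confs (insert a I)"
  unfolding confs_def by (auto simp: PiE_iff extensional_def)

lemma confs_eqI: "s \<in> confs I \<Longrightarrow> t \<in> confs I \<Longrightarrow> (\<And>j. j \<in> I \<Longrightarrow> s j = t j) \<Longrightarrow> s = t"
  unfolding confs_def by (rule PiE_ext) auto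

lemma UNIV_spin: "(UNIV :: spin set) = {Up, Down}"
  using spin.exhaust by blast

lemma sum_spin: "(\<Sum>x\<in>(UNIV :: spin set). f x) = f Up + f Down"
  by (simp add: UNIV_spin)

text \<open>Site \<open>0\<close> is counted too, so that an exchange between the auxiliary and a
  quantum site leaves the count unchanged.\<close>

definition downs :: "nat \<Rightarrow> conf \<Rightarrow> nat" where
  "downs N s = (\<Sum>n\<in>{0..N}. if s n = Down then 1 else 0)"

text \<open>The nodes of the only contributing path: \<open>j = 0\<close> is all up,
  \<open>j = N\<close> all down.\<close>

definition step_conf :: "nat \<Rightarrow> nat \<Rightarrow> conf" where
  "step_conf N j = (\<lambda>n\<in>{1..N}. if n \<le> j then Down else Up)"

lemma step_conf_in_confs: "step_conf N j \<in> confs {1..N}"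
  unfolding step_conf_def confs_def by auto

lemma atLeast0_insert: "insert 0 {1..N} = {0..N::nat}"
  by auto

lemma aux_conf_in_confs: "s \<in> confs {1..N} \<Longrightarrow> s(0 := x) \<in> confs {0..N}"
  using fun_upd_insert_confs[of s "{1..N}" 0 x] unfolding atLeast0_insert .

lemma downs_split:
  "downs N s = (if s 0 = Down then 1 else 0) + (\<Sum>n\<in>{1..N}. if s n = Down then 1 else 0)"
  unfolding downs_def atLeast0_insert[symmetric] by (subst sum.insert) auto

lemma downs_upd0:
  "downs N (s(0 := x)) = (if x = Down then 1 else 0) + (\<Sum>n\<in>{1..N}. if s n = Down then 1 else 0)"
  unfolding downs_split by (auto intro!: sum.cong)

lemma downs_step_conf:
  assumes "j \<le> N"
  shows "downs N ((step_conf N j)(0 := Up)) = j"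
proof -
  have "(\<Sum>n\<in>{1..N}. if step_conf N j n = Down then 1 else 0) = (\<Sum>n\<in>{1..N}. if n \<le> j then 1 else (0::nat))"
    by (rule sum.cong) (auto simp: step_conf_def)
  also have "\<dots> = card {n\<in>{1..N}. n \<le> j}"
    by (simp add: sum.If_cases Int_def)
  also have "{n\<in>{1..N}. n \<le> j} = {1..j}"
    using assms by auto
  finally show ?thesis by (simp add: downs_upd0)
qed

section \<open>Row action of the elementary operators\<close>

lemma op_mult_op_id:
  "finite I \<Longrightarrow> t \<in> confs I \<Longrightarrow> op_mult I A op_id s t = A s t"
  unfolding op_mult_def op_id_def by (simp add: finite_confs sum.delta if_distrib cong: if_cong)

text \<open>A row of \<open>R_op\<close> is supported on the configurations that agree with
  \<open>s\<close> off \<open>a\<close> and \<open>b\<close>, so the sum collapses to four terms. As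
  \<open>J\<close> avoids both sites, the dynamical parameter can be read off the row
  \<open>s\<close>, although \<open>R_op\<close> evaluates it on the column.\<close>

lemma op_mult_R_op:
  assumes s: "s \<in> confs {0..N}" and ab: "a \<in> {0..N}" "b \<in> {0..N}" "a \<noteq> b"
    and J: "J \<subseteq> {0..N} - {a, b}"
  shows "op_mult {0..N} (R_op \<eta> N a b J u \<beta>) B s t =
    (\<Sum>x\<in>UNIV. \<Sum>y\<in>UNIV. R_SOS \<eta> u (\<beta> + (\<Sum>j\<in>J. sz (s j))) (s a, s b) (x, y)
       * B (s(a := x, b := y)) t)"
proof -
  let ?h = "\<lambda>(x, y). s(a := x, b := y)"
  let ?R = "R_op \<eta> N a b J u \<beta>"
  have inj: "inj_on ?h UNIV"
    using ab(3) by (auto simp: inj_on_def fun_eq_iff split: if_splits)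
  have sub: "range ?h \<subseteq> confs {0..N}"
    using s ab by (auto intro!: fun_upd_confs)
  have zero: "?R s w * B w t = 0" if "w \<in> confs {0..N} - range ?h" for w
  proof -
    have "\<not> (\<forall>j\<in>{0..N} - {a, b}. s j = w j)"
    proof
      assume "\<forall>j\<in>{0..N} - {a, b}. s j = w j"
      then have "w = ?h (w a, w b)"
        using s ab that by (intro confs_eqI[of w "{0..N}"]) (auto intro!: fun_upd_confs)
      then have "w \<in> range ?h" by blast
      with that show False by blast
    qed
    then show ?thesis unfolding R_op_def by auto
  qed
  have "op_mult {0..N} ?R B s t = (\<Sum>w\<in>range ?h. ?R s w * B w t)"
    unfolding op_mult_def
    by (rule sum.mono_neutral_right) (use zero sub in \<open>auto simp: finite_confs\<close>)
  also have "\<dots> = (\<Sum>p\<in>UNIV. ?R s (?h p) * B (?h p) t)"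
    using inj by (simp add: sum.reindex)
  also have "\<dots> = (\<Sum>x\<in>UNIV. \<Sum>y\<in>UNIV. ?R s (?h (x, y)) * B (?h (x, y)) t)"
    unfolding sum.cartesian_product UNIV_Times_UNIV by (simp add: split_def)
  also have "\<dots> = (\<Sum>x\<in>UNIV. \<Sum>y\<in>UNIV. R_SOS \<eta> u (\<beta> + (\<Sum>j\<in>J. sz (s j))) (s a, s b) (x, y)
       * B (s(a := x, b := y)) t)"
  proof (intro sum.cong refl)
    fix x y
    have "(\<Sum>j\<in>J. sz (?h (x, y) j)) = (\<Sum>j\<in>J. sz (s j))"
      using J by (intro sum.cong) auto
    then show "?R s (?h (x, y)) * B (?h (x, y)) t =
      R_SOS \<eta> u (\<beta> + (\<Sum>j\<in>J. sz (s j))) (s a, s b) (x, y) * B (s(a := x, b := y)) t"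
      using ab(3) unfolding R_op_def by simp
  qed
  finally show ?thesis .
qed

text \<open>The boundary matrix acts on site \<open>0\<close> only and its dynamical parameter sees
  only the other sites; hence two terms, with the parameter again read off the row.\<close>

lemma op_mult_K_op:
  assumes s: "s \<in> confs {0..N}"
  shows "op_mult {0..N} (K_op N \<eta> \<alpha> \<zeta> \<kappa> \<tau> u \<beta>) B s t =
    (\<Sum>x\<in>UNIV. K_SOS \<eta> \<alpha> \<zeta> \<kappa> \<tau> u (\<beta> + (\<Sum>j\<in>{1..N}. sz (s j))) $ s 0 $ x * B (s(0 := x)) t)"
proof -
  let ?h = "\<lambda>x. s(0 := x)"
  let ?K = "K_op N \<eta> \<alpha> \<zeta> \<kappa> \<tau> u \<beta>"
  have inj: "inj_on ?h UNIV"
    by (auto simp: inj_on_def fun_eq_iff split: if_splits)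
  have sub: "range ?h \<subseteq> confs {0..N}"
    using s by (auto intro!: fun_upd_confs)
  have zero: "?K s w * B w t = 0" if "w \<in> confs {0..N} - range ?h" for w
  proof -
    have "\<not> (\<forall>j\<in>{1..N}. s j = w j)"
    proof
      assume "\<forall>j\<in>{1..N}. s j = w j"
      then have "w = ?h (w 0)"
        using s that by (intro confs_eqI[of w "{0..N}"]) (auto intro!: fun_upd_confs)
      then have "w \<in> range ?h" by blast
      with that show False by blast
    qed
    then show ?thesis unfolding K_op_def by auto
  qed
  have "op_mult {0..N} ?K B s t = (\<Sum>w\<in>range ?h. ?K s w * B w t)"
    unfolding op_mult_def
    by (rule sum.mono_neutral_right) (use zero sub in \<open>auto simp: finite_confs\<close>)
  also have "\<dots> = (\<Sum>x\<in>UNIV. ?K s (?h x) * B (?h x) t)"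
    using inj by (simp add: sum.reindex)
  also have "\<dots> = (\<Sum>x\<in>UNIV. K_SOS \<eta> \<alpha> \<zeta> \<kappa> \<tau> u (\<beta> + (\<Sum>j\<in>{1..N}. sz (s j))) $ s 0 $ x
       * B (s(0 := x)) t)"
    unfolding K_op_def by (intro sum.cong refl) (auto intro!: sum.cong)
  finally show ?thesis .
qed

section \<open>Conservation of the number of down spins\<close>

text \<open>Matrix form of commuting with the total spin of all sites, auxiliary space
  included.\<close>

definition conserves_downs :: "nat \<Rightarrow> operator \<Rightarrow> bool" where
  "conserves_downs N A \<longleftrightarrow>
    (\<forall>s\<in>confs {0..N}. \<forall>t\<in>confs {0..N}. A s t \<noteq> 0 \<longrightarrow> downs N s = downs N t)"

text \<open>This is the ice rule of the six-vertex model, read off the six entries that may be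
  nonzero.\<close>

lemma R_SOS_nonzero:
  "R_SOS \<eta> u \<beta> p q \<noteq> 0 \<Longrightarrow> q = p \<or> q = (snd p, fst p)"
  by (induct \<eta> u \<beta> p q rule: R_SOS.induct) auto

lemma conserves_downs_R_op:
  assumes ab: "a \<in> {0..N}" "b \<in> {0..N}" "a \<noteq> b"
  shows "conserves_downs N (R_op \<eta> N a b J u \<beta>)"
  unfolding conserves_downs_def
proof (intro ballI impI)
  fix s t assume nz: "R_op \<eta> N a b J u \<beta> s t \<noteq> 0"
  then have eq: "\<forall>j\<in>{0..N} - {a, b}. s j = t j"
    and "R_SOS \<eta> u (\<beta> + (\<Sum>j\<in>J. sz (t j))) (s a, s b) (t a, t b) \<noteq> 0"
    unfolding R_op_def by (auto split: if_splits)
  then have p: "(t a, t b) = (s a, s b) \<or> (t a, t b) = (s b, s a)"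
    using R_SOS_nonzero by fastforce
  \<comment> \<open>Off \<open>a\<close> and \<open>b\<close> the two configurations agree; keeping
    or exchanging the two spins preserves their joint contribution.\<close>
  have split: "downs N r = (if r a = Down then 1 else 0) + ((if r b = Down then 1 else 0)
      + (\<Sum>n\<in>{0..N} - {a, b}. if r n = Down then 1 else 0))" for r
  proof -
    have "{0..N} = insert a (insert b ({0..N} - {a, b}))" using ab by auto
    then have "downs N r = (\<Sum>n\<in>insert a (insert b ({0..N} - {a, b})). if r n = Down then 1 else 0)"
      unfolding downs_def by simp
    then show ?thesis using ab by simp
  qed
  have "(\<Sum>n\<in>{0..N} - {a, b}. if s n = Down then 1 else 0) =
      (\<Sum>n\<in>{0..N} - {a, b}. if t n = Down then 1 else (0::nat))"
    using eq by (intro sum.cong) auto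
  then show "downs N s = downs N t"
    unfolding split using p by auto
qed

lemma conserves_downs_op_prod:
  assumes "\<forall>A\<in>set As. conserves_downs N A"
  shows "conserves_downs N (op_prod {0..N} As)"
  using assms
proof (induction As)
  case Nil
  then show ?case by (simp add: op_prod_def conserves_downs_def op_id_def)
next
  case (Cons A As)
  then have A: "conserves_downs N A" and B: "conserves_downs N (op_prod {0..N} As)" by auto
  have "downs N s = downs N t"
    if st: "s \<in> confs {0..N}" "t \<in> confs {0..N}" and nz: "op_prod {0..N} (A # As) s t \<noteq> 0" for s t
  proof -
    have "(\<Sum>w\<in>confs {0..N}. A s w * op_prod {0..N} As w t) \<noteq> 0"
      using nz by (simp add: op_prod_def op_mult_def)
    then obtain w where "w \<in> confs {0..N}" "A s w * op_prod {0..N} As w t \<noteq> 0"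
      by (meson sum.not_neutral_contains_not_neutral)
    then show ?thesis using A B st unfolding conserves_downs_def
      by (metis mult_not_zero)
  qed
  then show ?case unfolding conserves_downs_def by blast
qed

lemma conserves_downs_M_SOS: "conserves_downs N (M_SOS N \<eta> \<xi> u \<beta>)"
  unfolding M_SOS_def
  by (rule conserves_downs_op_prod) (auto intro!: conserves_downs_R_op)

lemma conserves_downs_Mhat_SOS: "conserves_downs N (Mhat_SOS N \<eta> \<xi> u \<beta>)"
  unfolding Mhat_SOS_def
  by (rule conserves_downs_op_prod) (auto intro!: conserves_downs_R_op)

section \<open>Rows of the monodromy matrices\<close>

lemma prod_atLeast1_Suc: "(\<Prod>n\<in>{Suc 0..Suc k}. f n) = f (Suc k) * (\<Prod>n\<in>{Suc 0..k}. f n)"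
  for f :: "nat \<Rightarrow> complex"
  by (simp add: mult.commute)

context
  fixes N :: nat and \<eta> u \<beta> :: complex and \<xi> :: "nat \<Rightarrow> complex"
begin

text \<open>The last \<open>k\<close> factors X_k ... X_1, with the dynamical shifts of the full
  chain. A row meets the leftmost factor first, so peeling lowers \<open>k\<close> to the empty
  product at \<open>0\<close>.\<close>

private definition M_part :: "nat \<Rightarrow> operator" where
  "M_part k = op_prod {0..N}
     (map (\<lambda>n. R_op \<eta> N n 0 {n<..N} (u - \<xi> n - \<eta> / 2) \<beta>) (rev [1..<Suc k]))"

text \<open>The factors Y_k ... Y_N; here peeling raises \<open>k\<close>, up to the empty product
  at \<open>Suc N\<close>.\<close>

private definition Mhat_part :: "nat \<Rightarrow> operator" where
  "Mhat_part k = op_prod {0..N}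
     (map (\<lambda>n. R_op \<eta> N 0 n {n<..N} (u + \<xi> n - \<eta> / 2) \<beta>) [k..<Suc N])"

private lemma M_part_0: "M_part 0 = op_id"
  by (simp add: M_part_def op_prod_def)

private lemma M_part_Suc:
  assumes "s \<in> confs {0..N}" "Suc k \<le> N"
  shows "M_part (Suc k) s t = (\<Sum>x\<in>UNIV. \<Sum>y\<in>UNIV.
    R_SOS \<eta> (u - \<xi> (Suc k) - \<eta> / 2) (\<beta> + (\<Sum>j\<in>{Suc k<..N}. sz (s j))) (s (Suc k), s 0) (x, y)
       * M_part k (s(Suc k := x, 0 := y)) t)"
proof -
  have "M_part (Suc k) = op_mult {0..N}
     (R_op \<eta> N (Suc k) 0 {Suc k<..N} (u - \<xi> (Suc k) - \<eta> / 2) \<beta>) (M_part k)"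
    by (simp add: M_part_def op_prod_def)
  then show ?thesis using assms by (simp add: op_mult_R_op subset_iff)
qed

private lemma Mhat_part_last: "Mhat_part (Suc N) = op_id"
  by (simp add: Mhat_part_def op_prod_def)

private lemma Mhat_part_rec:
  assumes "s \<in> confs {0..N}" "1 \<le> k" "k \<le> N"
  shows "Mhat_part k s t = (\<Sum>x\<in>UNIV. \<Sum>y\<in>UNIV.
    R_SOS \<eta> (u + \<xi> k - \<eta> / 2) (\<beta> + (\<Sum>j\<in>{k<..N}. sz (s j))) (s 0, s k) (x, y)
       * Mhat_part (Suc k) (s(0 := x, k := y)) t)"
proof -
  have "Mhat_part k = op_mult {0..N}
     (R_op \<eta> N 0 k {k<..N} (u + \<xi> k - \<eta> / 2) \<beta>) (Mhat_part (Suc k))"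
    using assms by (simp add: Mhat_part_def op_prod_def upt_conv_Cons del: upt_Suc)
  then show ?thesis using assms by (simp add: op_mult_R_op subset_iff)
qed

text \<open>Two down spins leave the \<open>R\<close>-matrix only a diagonal entry, so the auxiliary
  spin stays down through all remaining factors and cannot end at \<open>t 0 = Up\<close>.\<close>

private lemma M_part_all_down:
  assumes "s \<in> confs {0..N}" "k \<le> N" "s 0 = Down" "\<forall>n\<in>{1..k}. s n = Down" "t 0 = Up"
  shows "M_part k s t = 0"
  using assms(2,4)
proof (induction k)
  case 0
  then show ?case using assms by (auto simp: M_part_0 op_id_def)
next
  case (Suc k)
  have "s(Suc k := Down, 0 := Down) = s" using Suc.prems assms(3) by (auto simp: fun_eq_iff)
  then show ?case using Suc assms(1,3)
    by (simp add: M_part_Suc sum_spin)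
qed

text \<open>An up auxiliary spin meeting a down site either passes with the displayed weight or
  turns down; in the second case only down sites are left and \<open>M_part_all_down\<close> removes
  the term.\<close>

private lemma M_part_row_down:
  assumes "s \<in> confs {0..N}" "k \<le> N" "s 0 = Up" "\<forall>n\<in>{1..k}. s n = Down" "t 0 = Up"
  shows "M_part k s t = (if t = s then \<Prod>n\<in>{1..k}.
      sinh (\<eta> * (\<beta> + (\<Sum>j\<in>{n<..N}. sz (s j)) - 1)) / sinh (\<eta> * (\<beta> + (\<Sum>j\<in>{n<..N}. sz (s j))))
      * sinh (u - \<xi> n - \<eta> / 2) else 0)"
  using assms(2,4)
proof (induction k)
  case 0
  then show ?case using assms by (auto simp: M_part_0 op_id_def)
next
  case (Suc k)
  have 1: "s(Suc k := Down, 0 := Up) = s" using Suc.prems assms(3) by (auto simp: fun_eq_iff)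
  have 2: "M_part k (s(Suc k := Up, 0 := Down)) t = 0"
    using Suc.prems assms(1,5)
    by (intro M_part_all_down) (auto intro!: fun_upd_confs)
  show ?case using Suc assms(1,3) 1 2
    by (simp add: M_part_Suc sum_spin prod_atLeast1_Suc del: prod.cl_ivl_Suc)
qed

text \<open>The factors act from site \<open>N\<close> downwards: the auxiliary spin first passes
  the up sites above \<open>j\<close>, where only the diagonal weight is possible, and then meets
  the down block of \<open>M_part_row_down\<close>, the base case of the induction.\<close>

lemma M_SOS_row:
  assumes s: "s \<in> confs {0..N}" "s 0 = Up" and j: "j \<le> N"
    and dn: "\<forall>n\<in>{1..j}. s n = Down" and up: "\<forall>n\<in>{j<..N}. s n = Up" and t: "t 0 = Up"
  shows "M_SOS N \<eta> \<xi> u \<beta> s t = (if t = s then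
      (\<Prod>n\<in>{1..j}. sinh (\<eta> * (\<beta> + (\<Sum>i\<in>{n<..N}. sz (s i)) - 1))
        / sinh (\<eta> * (\<beta> + (\<Sum>i\<in>{n<..N}. sz (s i)))) * sinh (u - \<xi> n - \<eta> / 2))
      * (\<Prod>n\<in>{j<..N}. sinh (u - \<xi> n + \<eta> / 2)) else 0)"
proof -
  have "M_part k s t = (if t = s then
      (\<Prod>n\<in>{1..j}. sinh (\<eta> * (\<beta> + (\<Sum>i\<in>{n<..N}. sz (s i)) - 1))
        / sinh (\<eta> * (\<beta> + (\<Sum>i\<in>{n<..N}. sz (s i)))) * sinh (u - \<xi> n - \<eta> / 2))
      * (\<Prod>n\<in>{j<..k}. sinh (u - \<xi> n + \<eta> / 2)) else 0)" if "j \<le> k" "k \<le> N" for k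
    using that
  proof (induction k rule: dec_induct)
    case base
    then show ?case using M_part_row_down[of s j t] s j dn t by simp
  next
    case (step k)
    have 1: "s(Suc k := Up, 0 := Up) = s" using step up s by (auto simp: fun_eq_iff)
    have 2: "s (Suc k) = Up" using step up by auto
    have 3: "{j<..Suc k} = insert (Suc k) {j<..k}" using step by auto
    have 4: "u - \<xi> (Suc k) - \<eta> / 2 + \<eta> = u - \<xi> (Suc k) + \<eta> / 2" by (simp add: field_simps)
    show ?case using step s 1 2
      by (simp add: M_part_Suc sum_spin 3 4)
  qed
  from this[of N] j show ?thesis by (simp add: M_part_def M_SOS_def)
qed

text \<open>The tail behind the exchange in \<open>Mhat_SOS_row\<close>: only up spins are met, so
  each factor is diagonal.\<close>

private lemma Mhat_part_row_up:
  assumes "s \<in> confs {0..N}" "1 \<le> k" "k \<le> Suc N" "s 0 = Up" "\<forall>n\<in>{k..N}. s n = Up"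
  shows "Mhat_part k s t = (if t = s then \<Prod>n\<in>{k..N}. sinh (u + \<xi> n + \<eta> / 2) else 0)"
  using assms(3,2,5)
proof (induction k rule: inc_induct)
  case base
  then show ?case by (auto simp: Mhat_part_last op_id_def)
next
  case (step k)
  have 1: "s(0 := Up, k := Up) = s" using step assms by (auto simp: fun_eq_iff)
  have 2: "{k..N} = insert k {Suc k..N}" using step by auto
  have 3: "u + \<xi> k - \<eta> / 2 + \<eta> = u + \<xi> k + \<eta> / 2" by (simp add: field_simps)
  show ?case using step assms(1,4) 1
    by (simp add: Mhat_part_rec sum_spin 2 3)
qed

text \<open>The down auxiliary spin passes the down sites below \<open>j\<close> diagonally. At site
  \<open>j\<close> the spectral argument is zero, the diagonal entry vanishes and the spins are
  exchanged; afterwards all spins met are up.\<close>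

lemma Mhat_SOS_row:
  assumes s: "s \<in> confs {0..N}" "s 0 = Down" and j: "1 \<le> j" "j \<le> N"
    and dn: "\<forall>n\<in>{1..<j}. s n = Down" and up: "\<forall>n\<in>{j..N}. s n = Up"
    and nz: "sinh (\<eta> * (\<beta> + of_nat (N - j))) \<noteq> 0"
    and u: "u = \<eta> / 2 - \<xi> j"
  shows "Mhat_SOS N \<eta> \<xi> u \<beta> s t =
    (if t = s(0 := Up, j := Down) then \<Prod>n\<in>{1..N}. sinh (u + \<xi> n + \<eta> / 2) else 0)"
proof -
  let ?t = "s(0 := Up, j := Down)"
  have "Mhat_part k s t = (if t = ?t then \<Prod>n\<in>{k..N}. sinh (u + \<xi> n + \<eta> / 2) else 0)"
    if "k \<le> j" "1 \<le> k" for k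
    using that
  proof (induction k rule: inc_induct)
    case base
    \<comment> \<open>\<open>0\<close> and \<open>nz\<close> reduce the exchange entry to
      \<open>sinh \<eta>\<close>; \<open>00\<close> identifies this value with the factor
      \<open>n = j\<close> of the uniform product.\<close>
    have 0: "u + \<xi> j - \<eta> / 2 = 0" and 00: "u + \<xi> j + \<eta> / 2 = \<eta>"
      by (simp_all add: u)
    have 1: "{j..N} = insert j {Suc j..N}" using j by auto
    have 2: "(\<Sum>i\<in>{j<..N}. sz (s i)) = of_nat (N - j)"
      using up by (simp add: sz_def)
    have 3: "Mhat_part (Suc j) ?t t =
        (if t = ?t then \<Prod>n\<in>{Suc j..N}. sinh (u + \<xi> n + \<eta> / 2) else 0)"
      using s j up by (intro Mhat_part_row_up) (auto intro!: fun_upd_confs)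
    have 4: "s j = Up" using up j by auto
    have "Mhat_part j s t = sinh \<eta> * Mhat_part (Suc j) ?t t"
      using s j 4 nz by (simp add: Mhat_part_rec sum_spin 0 2)
    then show ?case unfolding 3 1 by (simp add: 00 del: fun_upd_apply)
  next
    case (step k)
    have 1: "s(0 := Down, k := Down) = s" using step s dn by (auto simp: fun_eq_iff)
    have 2: "{k..N} = insert k {Suc k..N}" using step j by auto
    have 3: "u + \<xi> k - \<eta> / 2 + \<eta> = u + \<xi> k + \<eta> / 2" by (simp add: field_simps)
    have 4: "s k = Down" using step dn by auto
    show ?case using step s j 1 4
      by (simp add: Mhat_part_rec sum_spin 2 3)
  qed
  from this[of 1] j show ?thesis by (simp add: Mhat_part_def Mhat_SOS_def)
qed

end

section \<open>Matrix elements of \<open>\<A>\<^sub>-\<close>\<close>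

text \<open>Here \<open>w\<close> is the configuration between \<open>M_SOS\<close> and
  \<open>K_op\<close>, and \<open>x\<close> is the auxiliary spin behind the boundary.\<close>

lemma A_SOS_expand:
  assumes s: "s \<in> confs {1..N}" and t: "t \<in> confs {1..N}"
  shows "A_SOS N \<eta> \<alpha> \<zeta> \<kappa> \<tau> \<xi> u \<beta> s t =
    (\<Sum>w\<in>confs {0..N}. \<Sum>x\<in>UNIV. M_SOS N \<eta> \<xi> u \<beta> (s(0 := Up)) w *
      (K_SOS \<eta> \<alpha> \<zeta> \<kappa> \<tau> u (\<beta> + (\<Sum>j\<in>{1..N}. sz (w j))) $ w 0 $ x
        * Mhat_SOS N \<eta> \<xi> u \<beta> (w(0 := x)) (t(0 := Up))))"
proof -
  have "A_SOS N \<eta> \<alpha> \<zeta> \<kappa> \<tau> \<xi> u \<beta> s t =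
    (\<Sum>w\<in>confs {0..N}. M_SOS N \<eta> \<xi> u \<beta> (s(0 := Up)) w *
      op_mult {0..N} (K_op N \<eta> \<alpha> \<zeta> \<kappa> \<tau> u \<beta>) (op_mult {0..N} (Mhat_SOS N \<eta> \<xi> u \<beta>) op_id) w (t(0 := Up)))"
    unfolding A_SOS_def U_SOS_def op_prod_def by (simp add: op_mult_def)
  also have "\<dots> = (\<Sum>w\<in>confs {0..N}. \<Sum>x\<in>UNIV. M_SOS N \<eta> \<xi> u \<beta> (s(0 := Up)) w *
      (K_SOS \<eta> \<alpha> \<zeta> \<kappa> \<tau> u (\<beta> + (\<Sum>j\<in>{1..N}. sz (w j))) $ w 0 $ x
        * Mhat_SOS N \<eta> \<xi> u \<beta> (w(0 := x)) (t(0 := Up))))"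
    using t by (intro sum.cong refl)
      (simp add: op_mult_K_op op_mult_op_id aux_conf_in_confs sum_distrib_left)
  finally show ?thesis .
qed

text \<open>Both monodromy matrices conserve \<open>downs\<close>, and the boundary matrix touches
  only the auxiliary spin, so the count rises by at most one.\<close>

lemma A_SOS_downs:
  assumes s: "s \<in> confs {1..N}" and t: "t \<in> confs {1..N}"
    and less: "downs N (s(0 := Up)) + 1 < downs N (t(0 := Up))"
  shows "A_SOS N \<eta> \<alpha> \<zeta> \<kappa> \<tau> \<xi> u \<beta> s t = 0"
proof -
  have "M_SOS N \<eta> \<xi> u \<beta> (s(0 := Up)) w = 0 \<or> Mhat_SOS N \<eta> \<xi> u \<beta> (w(0 := x)) (t(0 := Up)) = 0"
    if w: "w \<in> confs {0..N}" for w x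
  proof (rule ccontr)
    assume "\<not> ?thesis"
    then have "downs N (s(0 := Up)) = downs N w" "downs N (w(0 := x)) = downs N (t(0 := Up))"
      using conserves_downs_M_SOS[of N \<eta> \<xi> u \<beta>] conserves_downs_Mhat_SOS[of N \<eta> \<xi> u \<beta>]
        aux_conf_in_confs[OF s] aux_conf_in_confs[OF t] fun_upd_confs[OF w, of 0] w
      unfolding conserves_downs_def by auto
    then show False using less by (auto simp: downs_upd0 downs_split[of N w] split: if_splits)
  qed
  then show ?thesis unfolding A_SOS_expand[OF s t]
    by (intro sum.neutral ballI) auto
qed

text \<open>As the count must rise by exactly one, the boundary matrix has to turn the auxiliary
  spin from up to down, which selects \<open>b_minus\<close>. The row of \<open>M_SOS\<close> is
  then diagonal, and \<open>Mhat_SOS_row\<close> fixes \<open>t\<close>.\<close>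

lemma A_SOS_step:
  fixes \<xi> :: "nat \<Rightarrow> complex"
  assumes j: "j < N" and t: "t \<in> confs {1..N}" "downs N (t(0 := Up)) = Suc j"
    and nz: "\<And>m::int. sinh (\<eta> * (\<beta> + of_int m)) \<noteq> 0"
  defines "u \<equiv> \<eta> / 2 - \<xi> (Suc j)"
  shows "A_SOS N \<eta> \<alpha> \<zeta> \<kappa> \<tau> \<xi> u \<beta> (step_conf N j) t = (if t = step_conf N (Suc j) then
      (sinh (\<eta> * (\<beta> + of_nat N - 2 * of_nat j)) / sinh (\<eta> * (\<beta> + of_nat N - of_nat j))
      * (\<Prod>n\<in>{1..j}. sinh (u - \<xi> n - \<eta> / 2)) * (\<Prod>n\<in>{j<..N}. sinh (u - \<xi> n + \<eta> / 2)))
      * b_minus \<eta> \<alpha> \<zeta> \<kappa> \<tau> u (\<beta> + of_nat N - 2 * of_nat j)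
      * (\<Prod>n\<in>{1..N}. sinh (u + \<xi> n + \<eta> / 2)) else 0)"
proof -
  let ?s = "(step_conf N j)(0 := Up)"
  let ?s' = "(step_conf N j)(0 := Down)"
  let ?t = "t(0 := Up)"
  let ?M = "M_SOS N \<eta> \<xi> u \<beta>" and ?H = "Mhat_SOS N \<eta> \<xi> u \<beta>"
  let ?b = "\<lambda>w x. K_SOS \<eta> \<alpha> \<zeta> \<kappa> \<tau> u (\<beta> + (\<Sum>j\<in>{1..N}. sz (w j))) $ w 0 $ x"
  note sc = step_conf_in_confs[of N j]
  have s: "?s \<in> confs {0..N}" and s': "?s' \<in> confs {0..N}"
    using aux_conf_in_confs[OF sc] by auto
  have "\<forall>n\<in>{1..j}. ?s n = Down" "\<forall>n\<in>{j<..N}. ?s n = Up"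
    using j by (auto simp: step_conf_def)
  note row = M_SOS_row[OF s fun_upd_same less_imp_le[OF j] this]
  \<comment> \<open>The counts of \<open>w\<close> and \<open>w(0 := x)\<close> differ by the
    required one only if \<open>w 0\<close> is up and \<open>x\<close> is down; \<open>row\<close>
    then leaves only \<open>w = ?s\<close>.\<close>
  have term0: "?M ?s w * (?b w x * ?H (w(0 := x)) ?t) = 0"
    if w: "w \<in> confs {0..N}" and "\<not> (w = ?s \<and> x = Down)" for w x
  proof (rule ccontr)
    assume ne: "?M ?s w * (?b w x * ?H (w(0 := x)) ?t) \<noteq> 0"
    then have "downs N ?s = downs N w" "downs N (w(0 := x)) = downs N ?t"
      using conserves_downs_M_SOS[of N \<eta> \<xi> u \<beta>] conserves_downs_Mhat_SOS[of N \<eta> \<xi> u \<beta>]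
        s aux_conf_in_confs[OF t(1)] fun_upd_confs[OF w, of 0] w
      unfolding conserves_downs_def by auto
    then have "downs N w = j" "downs N (w(0 := x)) = Suc j"
      using downs_step_conf[of j N] t(2) j by simp_all
    moreover obtain m where "downs N w = (if w 0 = Down then 1 else 0) + m"
      "downs N (w(0 := x)) = (if x = Down then 1 else 0) + m"
      using downs_split[of N w] downs_upd0[of N w x] by blast
    ultimately have "w 0 \<noteq> Down" and x: "x = Down"
      by (simp_all split: if_splits)
    then have "w 0 = Up" by (metis spin.exhaust)
    then have "w = ?s" using row[of w] ne by (metis mult_zero_left)
    with x that(2) show False by blast
  qed
  \<comment> \<open>Beyond site \<open>n\<close> there are \<open>j - n\<close> down and
    \<open>N - j\<close> up spins.\<close>
  have dyn: "(\<Sum>i\<in>{n<..N}. sz (?s i)) = of_nat N + of_nat n - 2 * of_nat j" if "n \<le> j" for n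
  proof -
    have "{n<..N} = {n<..j} \<union> {j<..N}" using that j by auto
    then have "(\<Sum>i\<in>{n<..N}. sz (?s i)) = (\<Sum>i\<in>{n<..j}. sz (?s i)) + (\<Sum>i\<in>{j<..N}. sz (?s i))"
      by (subst sum.union_disjoint[symmetric]) auto
    also have "(\<Sum>i\<in>{n<..j}. sz (?s i)) = (\<Sum>i\<in>{n<..j}. - 1)"
      using j by (intro sum.cong) (auto simp: step_conf_def sz_def)
    also have "(\<Sum>i\<in>{j<..N}. sz (?s i)) = (\<Sum>i\<in>{j<..N}. 1)"
      using j by (intro sum.cong) (auto simp: step_conf_def sz_def)
    finally show ?thesis using that j by (simp add: of_nat_diff)
  qed
  have "A_SOS N \<eta> \<alpha> \<zeta> \<kappa> \<tau> \<xi> u \<beta> (step_conf N j) t =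
    (\<Sum>w\<in>confs {0..N}. \<Sum>x\<in>UNIV. ?M ?s w * (?b w x * ?H (w(0 := x)) ?t))"
    by (rule A_SOS_expand[OF sc t(1)])
  also have "\<dots> = (\<Sum>w\<in>{?s}. \<Sum>x\<in>UNIV. ?M ?s w * (?b w x * ?H (w(0 := x)) ?t))"
    using s term0 by (intro sum.mono_neutral_right) (auto simp: finite_confs intro!: sum.neutral)
  also have "\<dots> = ?M ?s ?s * (?b ?s Down * ?H ?s' ?t)"
    using term0[OF s, of Up] by (simp add: sum_spin)
  also have "?b ?s Down = b_minus \<eta> \<alpha> \<zeta> \<kappa> \<tau> u (\<beta> + of_nat N - 2 * of_nat j)"
  proof -
    have "(\<Sum>i\<in>{1..N}. sz (?s i)) = of_nat N - 2 * of_nat j"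
      using dyn[of 0] by (simp add: atLeastSucAtMost_greaterThanAtMost)
    then show ?thesis unfolding b_minus_def by (simp add: add_diff_eq)
  qed
  also have "?M ?s ?s = sinh (\<eta> * (\<beta> + of_nat N - 2 * of_nat j)) / sinh (\<eta> * (\<beta> + of_nat N - of_nat j))
      * (\<Prod>n\<in>{1..j}. sinh (u - \<xi> n - \<eta> / 2)) * (\<Prod>n\<in>{j<..N}. sinh (u - \<xi> n + \<eta> / 2))"
  proof -
    \<comment> \<open>The dynamical parameter grows by one with \<open>n\<close>, so numerators and
      denominators are consecutive values of one sequence \<open>f\<close> and the product
      telescopes.\<close>
    define f where "f k = sinh (\<eta> * (\<beta> + of_nat N - 2 * of_nat j + of_nat k))" for k :: nat
    have fnz: "f k \<noteq> 0" for k
      using nz[of "int N - 2 * int j + int k"] by (simp add: f_def algebra_simps)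
    have tel: "(\<Prod>n\<in>{1..m}. f (n - 1) / f n) = f 0 / f m" for m
      by (induction m) (auto simp: fnz)
    have "?M ?s ?s = (\<Prod>n\<in>{1..j}. sinh (\<eta> * (\<beta> + (\<Sum>i\<in>{n<..N}. sz (?s i)) - 1))
        / sinh (\<eta> * (\<beta> + (\<Sum>i\<in>{n<..N}. sz (?s i)))) * sinh (u - \<xi> n - \<eta> / 2))
      * (\<Prod>n\<in>{j<..N}. sinh (u - \<xi> n + \<eta> / 2))"
      by (simp only: row[OF fun_upd_same] if_True simp_thms)
    also have "(\<Prod>n\<in>{1..j}. sinh (\<eta> * (\<beta> + (\<Sum>i\<in>{n<..N}. sz (?s i)) - 1))
        / sinh (\<eta> * (\<beta> + (\<Sum>i\<in>{n<..N}. sz (?s i)))) * sinh (u - \<xi> n - \<eta> / 2))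
      = (\<Prod>n\<in>{1..j}. f (n - 1) / f n * sinh (u - \<xi> n - \<eta> / 2))"
    proof (rule prod.cong[OF refl])
      fix n assume n: "n \<in> {1..j}"
      then have "\<beta> + (\<Sum>i\<in>{n<..N}. sz (?s i)) = \<beta> + of_nat N - 2 * of_nat j + of_nat n"
        using dyn[of n] by (simp add: algebra_simps)
      moreover have "\<beta> + of_nat N - 2 * of_nat j + of_nat n - 1 = \<beta> + of_nat N - 2 * of_nat j + of_nat (n - 1)"
        using n by (simp add: of_nat_diff)
      ultimately show "sinh (\<eta> * (\<beta> + (\<Sum>i\<in>{n<..N}. sz (?s i)) - 1))
        / sinh (\<eta> * (\<beta> + (\<Sum>i\<in>{n<..N}. sz (?s i)))) * sinh (u - \<xi> n - \<eta> / 2) =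
        f (n - 1) / f n * sinh (u - \<xi> n - \<eta> / 2)"
        unfolding f_def by presburger
    qed
    also have "\<dots> = f 0 / f j * (\<Prod>n\<in>{1..j}. sinh (u - \<xi> n - \<eta> / 2))"
      by (simp only: prod.distrib tel)
    also have "f 0 = sinh (\<eta> * (\<beta> + of_nat N - 2 * of_nat j))" by (simp add: f_def)
    also have "f j = sinh (\<eta> * (\<beta> + of_nat N - of_nat j))" by (simp add: f_def)
    finally show ?thesis .
  qed
  also have "?H ?s' ?t = (if t = step_conf N (Suc j) then
      \<Prod>n\<in>{1..N}. sinh (u + \<xi> n + \<eta> / 2) else 0)"
  proof -
    have nz': "sinh (\<eta> * (\<beta> + of_nat (N - Suc j))) \<noteq> 0"
      using nz[of "int (N - Suc j)"] by simp
    have "?H ?s' ?t = (if ?t = ?s'(0 := Up, Suc j := Down) then \<Prod>n\<in>{1..N}. sinh (u + \<xi> n + \<eta> / 2) else 0)"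
      using s' j nz' by (intro Mhat_SOS_row) (auto simp: step_conf_def u_def)
    moreover have "?s'(0 := Up, Suc j := Down) = (step_conf N (Suc j))(0 := Up)"
      using j by (auto simp: step_conf_def fun_eq_iff)
    \<comment> \<open>Elements of \<open>confs {1..N}\<close> are determined by the sites
      \<open>1..N\<close>, so overwriting site \<open>0\<close> loses nothing.\<close>
    moreover have "?t = (step_conf N (Suc j))(0 := Up) \<longleftrightarrow> t = step_conf N (Suc j)"
    proof
      assume eq: "?t = (step_conf N (Suc j))(0 := Up)"
      show "t = step_conf N (Suc j)"
      proof (rule confs_eqI[OF t(1) step_conf_in_confs])
        fix i assume "i \<in> {1..N}"
        then show "t i = step_conf N (Suc j) i" using fun_cong[OF eq, of i] by auto
      qed
    qed simp
    ultimately show ?thesis by simp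
  qed
  finally show ?thesis by simp
qed

text \<open>Reading columns from rows, each factor raises the number of down spins by at most one, so \<open>N\<close>
  factors leading from all up to all down raise it at every step. The path is then forced from the
  left; from the right it would not be.\<close>

lemma op_prod_step_path:
  assumes sel: "\<And>i s t. i < N \<Longrightarrow> s \<in> confs {1..N} \<Longrightarrow> t \<in> confs {1..N} \<Longrightarrow>
      downs N (s(0 := Up)) + 1 < downs N (t(0 := Up)) \<Longrightarrow> A (Suc i) s t = 0"
    and row: "\<And>i t. i < N \<Longrightarrow> t \<in> confs {1..N} \<Longrightarrow> downs N (t(0 := Up)) = Suc i \<Longrightarrow>
      A (Suc i) (step_conf N i) t = (if t = step_conf N (Suc i) then c (Suc i) else 0)"
  shows "op_prod {1..N} (map A [1..<Suc N]) (step_conf N 0) (step_conf N N) = (\<Prod>j\<in>{1..N}. c j)"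
proof -
  \<comment> \<open>The total weight of the paths from \<open>s\<close> to all down through the
    factors after the \<open>k\<close>-th.\<close>
  define W where "W k s = op_prod {1..N} (map A [Suc k..<Suc N]) s (step_conf N N)" for k s
  have W_rec: "W k s = (\<Sum>w\<in>confs {1..N}. A (Suc k) s w * W (Suc k) w)" if "k < N" for k s
    using that unfolding W_def op_prod_def
    by (subst upt_conv_Cons) (auto simp: op_mult_def simp del: upt_Suc)
  \<comment> \<open>With fewer than \<open>k\<close> down spins at the start, the
    \<open>N - k\<close> remaining factors cannot reach \<open>N\<close> of them.\<close>
  have "(\<forall>s\<in>confs {1..N}. downs N (s(0 := Up)) < k \<longrightarrow> W k s = 0) \<and>
      W k (step_conf N k) = (\<Prod>j\<in>{k<..N}. c j)" if "k \<le> N" for k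
    using that
  proof (induction k rule: inc_induct)
    case base
    have "W N s = op_id s (step_conf N N)" for s
      by (simp add: W_def op_prod_def)
    moreover have "s \<noteq> step_conf N N" if "downs N (s(0 := Up)) < N" for s
      using downs_step_conf[of N N] that by auto
    ultimately show ?case by (simp add: op_id_def del: fun_upd_apply)
  next
    case (step k)
    have "W k s = 0" if s: "s \<in> confs {1..N}" "downs N (s(0 := Up)) < k" for s
    proof -
      have "A (Suc k) s w * W (Suc k) w = 0" if w: "w \<in> confs {1..N}" for w
      proof (cases "downs N (w(0 := Up)) < Suc k")
        case True
        then have "W (Suc k) w = 0" using step.IH w by blast
        then show ?thesis by simp
      next
        case False
        then show ?thesis using sel[of k s w] s w step.hyps by auto
      qed
      then show ?thesis unfolding W_rec[OF step.hyps(2)] by (intro sum.neutral) blast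
    qed
    moreover have "W k (step_conf N k) = (\<Prod>j\<in>{k<..N}. c j)"
    proof -
      let ?t = "step_conf N (Suc k)"
      have "A (Suc k) (step_conf N k) w * W (Suc k) w = (if w = ?t then c (Suc k) * W (Suc k) ?t else 0)"
        if w: "w \<in> confs {1..N}" for w
      proof -
        have t: "downs N (?t(0 := Up)) = Suc k" using downs_step_conf[of "Suc k" N] step.hyps by simp
        have s: "downs N ((step_conf N k)(0 := Up)) = k" using downs_step_conf[of k N] step.hyps by simp
        \<comment> \<open>Below \<open>Suc k\<close> the induction hypothesis kills the remaining
          product, above it \<open>sel\<close> kills the factor, and at equality \<open>row\<close>
          leaves only \<open>?t\<close>.\<close>
        consider "downs N (w(0 := Up)) < Suc k" | "downs N (w(0 := Up)) = Suc k" | "k + 1 < downs N (w(0 := Up))"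
          by linarith
        then show ?thesis
        proof cases
          case 1
          then have "w \<noteq> ?t" using t by auto
          moreover have "W (Suc k) w = 0" using 1 step.IH w by blast
          ultimately show ?thesis by simp
        next
          case 2
          then show ?thesis using row[of k w] step.hyps w by auto
        next
          case 3
          then have "w \<noteq> ?t" using t by auto
          moreover have "A (Suc k) (step_conf N k) w = 0"
            using 3 sel[OF step.hyps(2) step_conf_in_confs w, of k] by (simp only: s)
          ultimately show ?thesis by simp
        qed
      qed
      then have "W k (step_conf N k) = (\<Sum>w\<in>confs {1..N}. if w = ?t then c (Suc k) * W (Suc k) ?t else 0)"
        unfolding W_rec[OF step.hyps(2)] by (intro sum.cong refl)
      also have "\<dots> = c (Suc k) * W (Suc k) ?t"
        by (simp add: finite_confs step_conf_in_confs del: One_nat_def)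
      also have "\<dots> = (\<Prod>j\<in>insert (Suc k) {Suc k<..N}. c j)"
        using step.IH by simp
      also have "insert (Suc k) {Suc k<..N} = {k<..N}" using step.hyps by auto
      finally show ?thesis .
    qed
    ultimately show ?case by blast
  qed
  from this[of 0] have "W 0 (step_conf N 0) = (\<Prod>j\<in>{0<..N}. c j)" by simp
  moreover have "{0<..N} = {1..N}" by auto
  ultimately show ?thesis by (simp add: W_def)
qed

section \<open>Evaluation of the normalization coefficient\<close>

lemma sinh_squared_diff:
  fixes x y :: complex
  shows "(sinh x)\<^sup>2 - (sinh y)\<^sup>2 = sinh (x - y) * sinh (x + y)"
proof -
  have "sinh (x - y) * sinh (x + y) = (sinh x)\<^sup>2 * (cosh y)\<^sup>2 - (cosh x)\<^sup>2 * (sinh y)\<^sup>2"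
    by (simp add: sinh_add sinh_diff algebra_simps power2_eq_square)
  also have "\<dots> = (sinh x)\<^sup>2 - (sinh y)\<^sup>2"
    by (simp add: cosh_square_eq algebra_simps)
  finally show ?thesis by simp
qed

text \<open>Factored by \<open>sinh_squared_diff\<close>, both products contain the same
  \<open>sinh (\<xi> k - \<xi> j)\<close>, since the common shift cancels in differences; only the
  sums are moved, by twice \<open>- \<eta> / 2\<close>.\<close>

lemma Vhat_quotient:
  assumes "Vhat N (xi_shift \<eta> \<xi> 1) \<noteq> 0"
  shows "Vhat N \<xi> / Vhat N (xi_shift \<eta> \<xi> 1) =
    (\<Prod>k\<in>{1..N}. \<Prod>j\<in>{1..<k}. sinh (\<xi> k + \<xi> j) / sinh (\<xi> k + \<xi> j - \<eta>))"
proof -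
  have eq: "(sinh (xi_shift \<eta> \<xi> 1 k))\<^sup>2 - (sinh (xi_shift \<eta> \<xi> 1 j))\<^sup>2 =
      sinh (\<xi> k - \<xi> j) * sinh (\<xi> k + \<xi> j - \<eta>)" for k j
    unfolding sinh_squared_diff xi_shift_def by (simp add: algebra_simps)
  \<comment> \<open>The shared factor divides the nonzero denominator, so it may be
    cancelled.\<close>
  have nz: "sinh (\<xi> k - \<xi> j) \<noteq> 0" if "k \<in> {1..N}" "j \<in> {1..<k}" for k j
  proof -
    have "(\<Prod>j\<in>{1..<k}. (sinh (xi_shift \<eta> \<xi> 1 k))\<^sup>2 - (sinh (xi_shift \<eta> \<xi> 1 j))\<^sup>2) \<noteq> 0"
      using assms that unfolding Vhat_def by auto
    then have "(sinh (xi_shift \<eta> \<xi> 1 k))\<^sup>2 - (sinh (xi_shift \<eta> \<xi> 1 j))\<^sup>2 \<noteq> 0"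
      using that by auto
    then show ?thesis unfolding eq by auto
  qed
  show ?thesis
    unfolding Vhat_def eq unfolding sinh_squared_diff prod_dividef[symmetric]
    by (intro prod.cong refl) (simp add: nz)
qed

theorem mainTheorem5:
  fixes N :: nat
    and \<eta> \<alpha> \<beta> \<zeta> \<kappa> \<tau> \<alpha>\<^sub>m \<beta>\<^sub>m :: complex
    and \<xi> :: "nat \<Rightarrow> complex"
    and g :: "complex \<Rightarrow> complex"
  assumes "N \<ge> 1"
    and "\<And>m::int. sinh (\<eta> * (\<beta> + of_int m)) \<noteq> 0"
    and "sinh \<zeta> \<noteq> 0" and "\<kappa> \<noteq> 0"
    and "sinh \<alpha>\<^sub>m * cosh \<beta>\<^sub>m = sinh \<zeta> / (2 * \<kappa>)"
    and "cosh \<alpha>\<^sub>m * sinh \<beta>\<^sub>m = cosh \<zeta> / (2 * \<kappa>)"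
    and "\<And>u. g (u + \<eta> / 2) * g (- u + \<eta> / 2) =
           - (((sinh u)\<^sup>2 - (sinh \<alpha>\<^sub>m)\<^sup>2) * ((sinh u)\<^sup>2 + (cosh \<beta>\<^sub>m)\<^sup>2)
               / ((sinh \<alpha>\<^sub>m)\<^sup>2 * (cosh \<beta>\<^sub>m)\<^sup>2))"
    and "\<And>j. j \<in> {1..N} \<Longrightarrow> A_coef N \<eta> \<xi> g (\<eta> / 2 - \<xi> j) \<noteq> 0"
    and "Vhat N (xi_shift \<eta> \<xi> 1) \<noteq> 0"
  shows "norm_coeff N \<eta> \<alpha> \<zeta> \<kappa> \<tau> g \<xi> \<beta> =
    (- 1) ^ N * Vhat N \<xi> * (Vhat N (xi_shift \<eta> \<xi> 0) / Vhat N (xi_shift \<eta> \<xi> 1)) *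
    (\<Prod>j\<in>{1..N}.
       b_minus \<eta> \<alpha> \<zeta> \<kappa> \<tau> (\<eta> / 2 - \<xi> j) (\<beta> + 1 + of_nat N - 2 * of_nat j) / g (\<eta> / 2 - \<xi> j) *
       (sinh (\<eta> * (\<beta> + 1 + of_nat N - 2 * of_nat j)) / sinh (\<eta> * (\<beta> + of_nat N - of_nat j))))"
proof -
  let ?u = "\<lambda>j. \<eta> / 2 - \<xi> j"
  let ?b = "\<lambda>j. b_minus \<eta> \<alpha> \<zeta> \<kappa> \<tau> (?u j) (\<beta> + 1 + of_nat N - 2 * of_nat j)"
  let ?r = "\<lambda>j. sinh (\<eta> * (\<beta> + 1 + of_nat N - 2 * of_nat j)) / sinh (\<eta> * (\<beta> + of_nat N - of_nat j))"
  \<comment> \<open>The weight of the \<open>j\<close>-th step before normalization: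
    \<open>A_SOS_step\<close> from \<open>j - 1\<close> down spins, at
    \<open>\<beta> - 1\<close>.\<close>
  define C where "C j = ?r j * (\<Prod>n\<in>{1..<j}. sinh (?u j - \<xi> n - \<eta> / 2))
      * (\<Prod>n\<in>{j..N}. sinh (?u j - \<xi> n + \<eta> / 2)) * ?b j * (\<Prod>n\<in>{1..N}. sinh (?u j + \<xi> n + \<eta> / 2))" for j
  have nz: "sinh (\<eta> * (\<beta> - 1 + of_int m)) \<noteq> 0" for m :: int
    using assms(2)[of "m - 1"] by (simp add: algebra_simps)
  have step0: "step_conf N 0 = all_up N" and stepN: "step_conf N N = all_down N"
    unfolding step_conf_def all_up_def all_down_def by (auto simp: restrict_def fun_eq_iff)
  let ?A = "\<lambda>j s t. A_SOS N \<eta> \<alpha> \<zeta> \<kappa> \<tau> \<xi> (?u j) (\<beta> - 1) s t / A_coef N \<eta> \<xi> g (?u j)"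
  have "op_prod {1..N} (map ?A [1..<Suc N]) (step_conf N 0) (step_conf N N)
      = (\<Prod>j\<in>{1..N}. C j / A_coef N \<eta> \<xi> g (?u j))"
  proof (rule op_prod_step_path)
    fix i s t assume "s \<in> confs {1..N}" "t \<in> confs {1..N}"
      "downs N (s(0 := Up)) + 1 < downs N (t(0 := Up))"
    then show "?A (Suc i) s t = 0" by (simp add: A_SOS_downs)
  next
    fix i t assume i: "i < N" and t: "t \<in> confs {1..N}" "downs N (t(0 := Up)) = Suc i"
    \<comment> \<open>Passing from \<open>i\<close> to \<open>Suc i\<close> lowers the two index
      terms by two and by one, which turns \<open>\<beta> - 1\<close> into
      \<open>\<beta> + 1\<close> and \<open>\<beta>\<close> respectively.\<close>
    have e1: "\<beta> - 1 + of_nat N - 2 * of_nat i = \<beta> + 1 + of_nat N - 2 * of_nat (Suc i)"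
      and e2: "\<beta> - 1 + of_nat N - of_nat i = \<beta> + of_nat N - of_nat (Suc i)"
      by (simp_all add: algebra_simps)
    have e3: "{1..<Suc i} = {1..i}" "{Suc i..N} = {i<..N}" by auto
    show "?A (Suc i) (step_conf N i) t =
      (if t = step_conf N (Suc i) then C (Suc i) / A_coef N \<eta> \<xi> g (?u (Suc i)) else 0)"
      unfolding A_SOS_step[OF i t nz] C_def e1 e2 e3 by simp
  qed
  then have nc: "norm_coeff N \<eta> \<alpha> \<zeta> \<kappa> \<tau> g \<xi> \<beta> = Vhat N (xi_shift \<eta> \<xi> 0) *
      (\<Prod>j\<in>{1..N}. C j / A_coef N \<eta> \<xi> g (?u j))"
    unfolding norm_coeff_def step0 stepN by simp
  \<comment> \<open>The part of \<open>a_fun\<close> over the sites \<open>j..N\<close> cancels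
    against the up sites of \<open>M_SOS\<close>, and \<open>d_fun\<close> cancels against
    \<open>Mhat_SOS\<close> up to sign. The sites below \<open>j\<close> leave one row of
    \<open>Vhat_quotient\<close>.\<close>
  have fac: "C j / A_coef N \<eta> \<xi> g (?u j) =
    (-1) ^ N * (\<Prod>n\<in>{1..<j}. sinh (\<xi> j + \<xi> n) / sinh (\<xi> j + \<xi> n - \<eta>)) * (?b j / g (?u j) * ?r j)"
    if j: "j \<in> {1..N}" for j
  proof -
    have "{1..N} = {1..<j} \<union> {j..N}" using j by auto
    then have a: "a_fun N \<eta> \<xi> (?u j) = (\<Prod>n\<in>{1..<j}. sinh (?u j - \<xi> n + \<eta> / 2))
        * (\<Prod>n\<in>{j..N}. sinh (?u j - \<xi> n + \<eta> / 2))"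
      unfolding a_fun_def by (subst prod.union_disjoint[symmetric]) auto
    have "d_fun N \<eta> \<xi> (- ?u j) = (\<Prod>n\<in>{1..N}. (- 1) * sinh (?u j + \<xi> n + \<eta> / 2))"
      unfolding d_fun_def
    proof (rule prod.cong[OF refl])
      fix n
      have "- ?u j - \<xi> n - \<eta> / 2 = - (?u j + \<xi> n + \<eta> / 2)" by simp
      then show "sinh (- ?u j - \<xi> n - \<eta> / 2) = (- 1) * sinh (?u j + \<xi> n + \<eta> / 2)"
        by (simp only: sinh_minus) simp
    qed
    then have d: "d_fun N \<eta> \<xi> (- ?u j) = (- 1) ^ N * (\<Prod>n\<in>{1..N}. sinh (?u j + \<xi> n + \<eta> / 2))"
      by (simp only: prod.distrib prod_constant card_atLeastAtMost) simp
    \<comment> \<open>Numerator and denominator arguments both change sign, and the two signs cancel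
      because \<open>sinh\<close> is odd.\<close>
    have q: "(\<Prod>n\<in>{1..<j}. sinh (\<xi> j + \<xi> n) / sinh (\<xi> j + \<xi> n - \<eta>)) =
      (\<Prod>n\<in>{1..<j}. sinh (?u j - \<xi> n - \<eta> / 2)) / (\<Prod>n\<in>{1..<j}. sinh (?u j - \<xi> n + \<eta> / 2))"
      unfolding prod_dividef[symmetric]
    proof (rule prod.cong[OF refl])
      fix n
      have "?u j - \<xi> n - \<eta> / 2 = - (\<xi> j + \<xi> n)" "?u j - \<xi> n + \<eta> / 2 = - (\<xi> j + \<xi> n - \<eta>)"
        by simp_all
      then show "sinh (\<xi> j + \<xi> n) / sinh (\<xi> j + \<xi> n - \<eta>) =
          sinh (?u j - \<xi> n - \<eta> / 2) / sinh (?u j - \<xi> n + \<eta> / 2)"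
        by (simp only: sinh_minus) simp
    qed
    have sgn: "x / (- 1) ^ N = (- 1) ^ N * x" for x :: complex
      by (cases "even N") auto
    \<comment> \<open>The common factors to cancel are \<open>p2\<close> and \<open>h\<close>;
      \<open>ne\<close> obtains their nonvanishing from that of \<open>A_coef\<close>.\<close>
    have quot: "r * p1 * p2 * b * h / (g' * (p3 * p2) * (m * h)) = (b / g' * r) * (p1 / p3) / m"
      if "p2 \<noteq> 0" "h \<noteq> 0" for r p1 p2 b h g' p3 m :: complex
      using that by (simp add: field_simps)
    have ne: "(\<Prod>n\<in>{j..N}. sinh (?u j - \<xi> n + \<eta> / 2)) \<noteq> 0" "(\<Prod>n\<in>{1..N}. sinh (?u j + \<xi> n + \<eta> / 2)) \<noteq> 0"
      using assms(8)[OF j] unfolding A_coef_def a d by auto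
    show ?thesis
      unfolding C_def A_coef_def a d q quot[OF ne] sgn by (simp only: mult_ac)
  qed
  have "(\<Prod>j\<in>{1..N}. C j / A_coef N \<eta> \<xi> g (?u j)) = (\<Prod>j\<in>{1..N}.
    (-1) ^ N * (\<Prod>n\<in>{1..<j}. sinh (\<xi> j + \<xi> n) / sinh (\<xi> j + \<xi> n - \<eta>)) * (?b j / g (?u j) * ?r j))"
    by (rule prod.cong[OF refl fac])
  also have "\<dots> = ((-1) ^ N) ^ N * (Vhat N \<xi> / Vhat N (xi_shift \<eta> \<xi> 1)) *
      (\<Prod>j\<in>{1..N}. ?b j / g (?u j) * ?r j)"
    unfolding Vhat_quotient[OF assms(9)] prod.distrib by simp
  \<comment> \<open>Each of the \<open>N\<close> factors \<open>d_fun\<close> gave a sign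
    \<open>(-1) ^ N\<close>; the square of \<open>N\<close> has the parity of
    \<open>N\<close>.\<close>
  also have "((-1) ^ N) ^ N = ((-1) ^ N :: complex)"
    by (cases "even N") auto
  finally show ?thesis unfolding nc by (simp add: mult_ac)
qed

end
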